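(* Let $1<p<N$, let $\mathfrak{Z}=\{z^{1},\dots,z^{p}\}$ be a set of orthonormal vectors in $\mathbb{C}^{N}$, and let $\phi=\phi(\mathfrak{Z})$ be the associated determinantal process on $\mathcal{N}=\{1,\dots,N\}$. Let $\mathfrak{A},\mathfrak{B}\subset 2^{\mathcal{N}}$ be increasing events generated by simple points. Then $$P\{\phi\in\mathfrak{A}\circ\mathfrak{B}\}\leq P\{\phi\in\mathfrak{A}\}\times P\{\phi\in\mathfrak{B}\}.$$
   Context: Determinantal process: for orthonormal vectors $z^{i}=(z^{i}_{1},\dots,z^{i}_{N})^{t}\in\mathbb{C}^N$, $i=1,\dots,p$, the process $\phi(\mathfrak{Z})$ is the random subset of $\mathcal{N}=\{1,\dots,N\}$ of cardinality $p$ whose law is given by $P\{\phi=\{i_1,\dots,i_p\}\}=\left|\det\left((z^{k}_{i_j})_{k,j=1,\dots,p}\right)\right|^{2}$ for every $p$-element subset $\{i_1,\dots,i_p\}\subset\mathcal{N}$. An event $\mathfrak{A}\subset 2^{\mathcal{N}}$ is increasing if $A\in\mathfrak{A}$ and $n\in\mathcal{N}$ imply $A\cup\{n\}\in\mathfrak{A}$. It is always assumed that $\emptyset\notin\mathfrak{A}$. For an increasing event $\mathfrak{A}$, $S(\mathfrak{A})$ denotes its set of (inclusion-)minimal elements, so that $A\in\mathfrak{A}$ if and only if $A\supset A'$ for some $A'\in S(\mathfrak{A})$; $\mathfrak{A}$ is said to be generated by $S(\mathfrak{A})$. It is generated by simple points if every element of $S(\mathfrak{A})$ is a singleton. For increasing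 events $\mathfrak{A},\mathfrak{B}$ the disjoint intersection is $$\mathfrak{A}\circ\mathfrak{B}=\{K\subset\mathcal{N}:\ \exists\, L\in\mathfrak{A},\ M\in\mathfrak{B},\ L,M\neq\emptyset,\ L\cap M=\emptyset,\ K\supset L\cup M\}.$$ *)

theory Defs
  imports
    "HOL-Probability.Probability"
    "Jordan_Normal_Form.Conjugate"
    "Jordan_Normal_Form.Determinant"
begin

text \<open>
  Vectors and matrices are those of Jordan\_Normal\_Form, whose indices start at 0. Accordingly the
  ground set of cardinality \<open>N\<close> is \<open>{..<N}\<close>, and the orthonormal vectors are
  \<open>z 0, \<dots>, z (p - 1)\<close>; values of \<open>z\<close> outside \<open>{..<p}\<close> play no role.
\<close>

no_notation vec_nth (infixl \<open>$\<close> 90)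

definition orthonormal_family :: "nat \<Rightarrow> nat \<Rightarrow> (nat \<Rightarrow> complex Matrix.vec) \<Rightarrow> bool" where
  "orthonormal_family N p z \<longleftrightarrow>
     (\<forall>k<p. z k \<in> carrier_vec N) \<and>
     (\<forall>k<p. \<forall>l<p. z k \<bullet>c z l = (if k = l then 1 else 0))"

text \<open>
  The \<open>p\<close>-by-\<open>p\<close> matrix with entries \<open>z\<^sup>k\<close> at \<open>i\<^sub>j\<close>, where \<open>S = {i\<^sub>0 < \<dots> < i\<^sub>p\<^sub>-\<^sub>1}\<close>. Listing \<open>S\<close> in a
  different order changes the determinant only by a sign.
\<close>

definition minor_matrix :: "nat \<Rightarrow> (nat \<Rightarrow> complex Matrix.vec) \<Rightarrow> nat set \<Rightarrow> complex Matrix.mat" where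
  "minor_matrix p z S = Matrix.mat p p (\<lambda>(k, j). z k $ (sorted_list_of_set S ! j))"

text \<open>
  \<open>\<phi>\<close> is a random subset of \<open>{..<N}\<close>, defined on an arbitrary probability space, with the
  prescribed law.
\<close>

definition determinantal_process ::
  "'w measure \<Rightarrow> ('w \<Rightarrow> nat set) \<Rightarrow> nat \<Rightarrow> nat \<Rightarrow> (nat \<Rightarrow> complex Matrix.vec) \<Rightarrow> bool" where
  "determinantal_process M \<phi> N p z \<longleftrightarrow>
     prob_space M \<and>
     \<phi> \<in> measurable M (count_space (Pow {..<N})) \<and>
     (AE \<omega> in M. card (\<phi> \<omega>) = p) \<and>
     (\<forall>S. S \<subseteq> {..<N} \<and> card S = p \<longrightarrow>
        \<P>(\<omega> in M. \<phi> \<omega> = S) = (cmod (Determinant.det (minor_matrix p z S)))\<^sup>2)"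

definition increasing_event :: "nat \<Rightarrow> nat set set \<Rightarrow> bool" where
  "increasing_event N \<AA> \<longleftrightarrow>
     \<AA> \<subseteq> Pow {..<N} \<and> (\<forall>A\<in>\<AA>. \<forall>n<N. A \<union> {n} \<in> \<AA>)"

definition minimal_elements :: "nat set set \<Rightarrow> nat set set" where
  "minimal_elements \<AA> = {A \<in> \<AA>. \<forall>A'\<in>\<AA>. A' \<subseteq> A \<longrightarrow> A' = A}"

definition generated_by_simple_points :: "nat set set \<Rightarrow> bool" where
  "generated_by_simple_points \<AA> \<longleftrightarrow> (\<forall>A\<in>minimal_elements \<AA>. is_singleton A)"

definition disjoint_intersection :: "nat \<Rightarrow> nat set set \<Rightarrow> nat set set \<Rightarrow> nat set set" where
  "disjoint_intersection N \<AA> \<BB> =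
     {K. K \<subseteq> {..<N} \<and>
        (\<exists>L\<in>\<AA>. \<exists>M\<in>\<BB>. L \<noteq> {} \<and> M \<noteq> {} \<and> L \<inter> M = {} \<and> L \<union> M \<subseteq> K)}"

end

theory Submission
  imports Defs
begin

text \<open>
  An increasing event generated by simple points is the event that the random set hits a fixed set
  of points. So the theorem says: for \<open>A, B \<subseteq> U = {..<N}\<close>, the probability that \<open>\<phi>\<close> contains a point
  of \<open>A\<close> and a different point of \<open>B\<close> is at most \<open>P(\<phi> hits A) P(\<phi> hits B)\<close>. Both sides
  are expressed through the avoidance function \<open>F S = P(\<phi> \<subseteq> S)\<close>, and the inequality comes from its
  log-submodularity:
  \<open>F S * F (S \<union> {x, y}) \<le> F (S \<union> {x}) * F (S \<union> {y})\<close>.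

  Why log-submodularity holds (\<open>minor_mass_log_submodular\<close>): by the Cauchy-Binet formula, \<open>F S\<close> is the
  determinant of the Gram matrix \<open>G\<close> of the vectors restricted to \<open>S\<close>, and adding a point \<open>x\<close> to \<open>S\<close>
  adds to \<open>G\<close> the rank-one matrix \<open>v\<^sub>x v\<^sub>x\<^sup>*\<close>, where \<open>v\<^sub>x\<close> lists the coordinates at \<open>x\<close>. If \<open>det G = 0\<close>
  there is nothing to prove. Otherwise put \<open>h x y = v\<^sub>x\<^sup>* G\<inverse> v\<^sub>y\<close>. The determinant lemma for low-rank
  updates (\<open>det_add_mult\<close>) multiplies \<open>F S\<close> by \<open>1 + h x x\<close> when \<open>x\<close> is added and by
  \<open>(1 + h x x) (1 + h y y) - h x y h y x\<close> when both points are. Since \<open>G\<inverse>\<close> is Hermitian,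
  \<open>h x y h y x = \<bar>h x y\<bar>\<^sup>2 \<ge> 0\<close>, and the two sides of the inequality differ by exactly
  \<open>(F S)\<^sup>2 \<bar>h x y\<bar>\<^sup>2\<close>.

  Why log-submodularity suffices (\<open>distinct_hits_bound\<close>): write \<open>C = A \<inter> B\<close> and \<open>D = U - (A \<union> B)\<close>. The
  event of two distinct hits fails exactly when \<open>\<phi>\<close> misses \<open>A\<close>, or misses \<open>B\<close>, or meets \<open>A \<union> B\<close> in
  a single point, and that point lies in \<open>C\<close>. With \<open>q\<close> the probability of the third case, the claim
  follows from \<open>F D - q \<le> F (U - A) * F (U - B)\<close>. Log-submodularity gives
  \<open>F D * F (U - C) \<le> F (U - A) * F (U - B)\<close>, so it remains to see \<open>F D * (1 - F (U - C)) \<le> q\<close>. By the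
  union bound \<open>1 - F (U - C)\<close> is at most the sum over \<open>c \<in> C\<close> of \<open>P(c \<in> \<phi>) = 1 - F (U - {c})\<close>, and
  \<open>F D * P(c \<in> \<phi>) \<le> F (D \<union> {c}) - F D\<close> is log-submodularity once more, together with \<open>F U = 1\<close>.
\<close>

section \<open>The Cauchy-Binet formula\<close>

lemma det_mat_fun: "Determinant.det (Matrix.mat p p (\<lambda>(i,j). c i j)) =
    (\<Sum>\<sigma> | \<sigma> permutes {0..<p}. signof \<sigma> * (\<Prod>i=0..<p. c i (\<sigma> i)))"
proof -
  have "(\<Prod>i=0..<p. Matrix.mat p p (\<lambda>(i,j). c i j) $$ (i, \<sigma> i)) = (\<Prod>i=0..<p. c i (\<sigma> i))"
    if "\<sigma> permutes {0..<p}" for \<sigma>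
    using permutes_in_image[OF that] by (intro prod.cong refl) auto
  then show ?thesis
    by (subst det_def'[where n=p]) (auto intro!: sum.cong)
qed

lemma det_mat_transpose: "Determinant.det (Matrix.mat p p (\<lambda>(i,j). c j i)) =
    Determinant.det (Matrix.mat p p (\<lambda>(i,j). c i j))"
proof -
  have "Matrix.mat p p (\<lambda>(i,j). c j i) = transpose_mat (Matrix.mat p p (\<lambda>(i,j). c i j))"
    by (intro eq_matI) auto
  then show ?thesis
    by (simp add: det_transpose[where n=p])
qed

text \<open>
  Once one enumeration \<open>e\<close> of \<open>T\<close> is chosen, every other one is \<open>e \<circ> \<pi>\<close> for a unique permutation \<open>\<pi>\<close>.
  In the proof of the Cauchy-Binet formula this turns a sum over the index maps with image \<open>T\<close> into
  a Leibniz sum.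
\<close>

lemma enumerations_bij_permutations:
  assumes e: "bij_betw e {0..<p} T"
  shows "bij_betw (\<lambda>\<pi>. restrict (e \<circ> \<pi>) {0..<p}) {\<pi>. \<pi> permutes {0..<p}}
           {f \<in> {0..<p} \<rightarrow>\<^sub>E T. inj_on f {0..<p} \<and> f ` {0..<p} = T}"
proof -
  let ?I = "{0..<p}" let ?g = "inv_into ?I e"
  show ?thesis
  proof (rule bij_betw_byWitness[where f' = "\<lambda>f i. if i \<in> ?I then ?g (f i) else i"])
    show "\<forall>\<pi>\<in>{\<pi>. \<pi> permutes ?I}. (\<lambda>i. if i \<in> ?I then ?g (restrict (e \<circ> \<pi>) ?I i) else i) = \<pi>"
    proof (intro ballI ext)
      fix \<pi> i assume "\<pi> \<in> {\<pi>. \<pi> permutes ?I}"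
      then have \<pi>: "\<pi> permutes ?I" by simp
      show "(if i \<in> ?I then ?g (restrict (e \<circ> \<pi>) ?I i) else i) = \<pi> i"
        using bij_betw_imp_inj_on[OF e] permutes_in_image[OF \<pi>, of i] permutes_not_in[OF \<pi>, of i]
        by auto
    qed
  next
    show "\<forall>f\<in>{f \<in> ?I \<rightarrow>\<^sub>E T. inj_on f ?I \<and> f ` ?I = T}.
            restrict (e \<circ> (\<lambda>i. if i \<in> ?I then ?g (f i) else i)) ?I = f"
    proof (intro ballI ext)
      fix f i assume f: "f \<in> {f \<in> ?I \<rightarrow>\<^sub>E T. inj_on f ?I \<and> f ` ?I = T}"
      show "restrict (e \<circ> (\<lambda>i. if i \<in> ?I then ?g (f i) else i)) ?I i = f i"
        using f bij_betw_inv_into_right[OF e, of "f i"]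
        by (auto simp: PiE_def extensional_def restrict_def)
    qed
  next
    show "(\<lambda>\<pi>. restrict (e \<circ> \<pi>) ?I) ` {\<pi>. \<pi> permutes ?I}
            \<subseteq> {f \<in> ?I \<rightarrow>\<^sub>E T. inj_on f ?I \<and> f ` ?I = T}"
    proof clarify
      fix \<pi> assume \<pi>: "\<pi> permutes ?I"
      have "bij_betw (e \<circ> \<pi>) ?I T"
        using bij_betw_trans[OF permutes_imp_bij[OF \<pi>] e] .
      then have "bij_betw (restrict (e \<circ> \<pi>) ?I) ?I T"
        by (rule bij_betw_cong[THEN iffD1, rotated]) auto
      then show "restrict (e \<circ> \<pi>) ?I \<in> ?I \<rightarrow>\<^sub>E T \<and> inj_on (restrict (e \<circ> \<pi>) ?I) ?I \<and> restrict (e \<circ> \<pi>) ?I ` ?I = T"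
        unfolding bij_betw_def by (auto simp del: restrict_apply)
    qed
  next
    show "(\<lambda>f i. if i \<in> ?I then ?g (f i) else i) ` {f \<in> ?I \<rightarrow>\<^sub>E T. inj_on f ?I \<and> f ` ?I = T}
            \<subseteq> {\<pi>. \<pi> permutes ?I}"
    proof clarify
      fix f assume f: "inj_on f ?I" "T = f ` ?I"
      have "bij_betw (?g \<circ> f) ?I ?I"
        using f by (intro bij_betw_trans[OF _ bij_betw_inv_into[OF e]]) (auto simp: bij_betw_def)
      then have "bij_betw (\<lambda>i. if i \<in> ?I then ?g (f i) else i) ?I ?I"
        by (rule bij_betw_cong[THEN iffD1, rotated]) auto
      then show "(\<lambda>i. if i \<in> ?I then ?g (f i) else i) permutes ?I"
        by (rule bij_imp_permutes) auto
    qed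
  qed
qed

text \<open>
  Expanding the product of sums in the Leibniz formula leaves a sum over index maps \<open>f\<close> into \<open>S\<close>.
  Maps that are not injective contribute a determinant with two equal rows, hence nothing. The
  injective ones are grouped by their image \<open>T\<close>: those with image \<open>T\<close> are the enumerations of \<open>T\<close>, and
  the signs that they produce in the second determinant recombine the diagonal products into the
  first one.
\<close>

lemma Cauchy_Binet:
  fixes a b :: "nat \<Rightarrow> 's::linorder \<Rightarrow> 'a::comm_ring_1"
  assumes fin: "finite S"
  shows "Determinant.det (Matrix.mat p p (\<lambda>(i,j). \<Sum>s\<in>S. a i s * b j s)) =
    (\<Sum>T | T \<subseteq> S \<and> card T = p.
       Determinant.det (Matrix.mat p p (\<lambda>(i,j). a i (sorted_list_of_set T ! j))) *
       Determinant.det (Matrix.mat p p (\<lambda>(i,j). b i (sorted_list_of_set T ! j))))"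
proof -
  let ?I = "{0..<p}"
  \<comment> \<open>One row per point: reordering the points then permutes rows.\<close>
  define M where "M c f = Determinant.det (Matrix.mat p p (\<lambda>(i,j). c j (f i)))"
    for c :: "nat \<Rightarrow> 's \<Rightarrow> 'a" and f :: "nat \<Rightarrow> 's"
  have M_eq: "M c f = (\<Sum>\<sigma> | \<sigma> permutes ?I. signof \<sigma> * (\<Prod>i=0..<p. c (\<sigma> i) (f i)))" for c f
    unfolding M_def by (rule det_mat_fun)
  have M_cong: "M c f = M c g" if "\<And>i. i < p \<Longrightarrow> f i = g i" for c f g
    unfolding M_eq using that by (auto intro!: sum.cong prod.cong)
  have M_noninj: "M c f = 0" if noninj: "\<not> inj_on f ?I" for c f
  proof -
    from noninj obtain i j where ij: "i < p" "j < p" "i \<noteq> j" "f i = f j"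
      unfolding inj_on_def by auto
    then have "Matrix.row (Matrix.mat p p (\<lambda>(i,j). c j (f i))) i =
               Matrix.row (Matrix.mat p p (\<lambda>(i,j). c j (f i))) j"
      by (intro eq_vecI) auto
    with ij show ?thesis
      unfolding M_def by (intro det_identical_rows[where n=p and i=i and j=j]) auto
  qed
  have M_perm: "M c (f \<circ> \<pi>) = signof \<pi> * M c f" if \<pi>: "\<pi> permutes ?I" for c f \<pi>
  proof -
    have "Matrix.mat p p (\<lambda>(i,j). c j ((f \<circ> \<pi>) i)) =
          Matrix.mat p p (\<lambda>(i,j). Matrix.mat p p (\<lambda>(i,j). c j (f i)) $$ (\<pi> i, j))"
      using permutes_in_image[OF \<pi>] by (intro eq_matI) auto
    then show ?thesis
      unfolding M_def using det_permute_rows[OF _ \<pi>, of "Matrix.mat p p (\<lambda>(i,j). c j (f i))"] by simp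
  qed
  have fibre: "(\<Sum>f | f \<in> ?I \<rightarrow>\<^sub>E S \<and> inj_on f ?I \<and> f ` ?I = T. (\<Prod>i=0..<p. a i (f i)) * M b f) =
      M a ((!) (sorted_list_of_set T)) * M b ((!) (sorted_list_of_set T))"
    if T: "T \<subseteq> S" "card T = p" for T
  proof -
    let ?e = "(!) (sorted_list_of_set T)"
    have e: "bij_betw ?e ?I T"
      using T finite_subset[OF T(1) fin]
      by (intro bij_betw_nth) (auto simp: atLeast0LessThan)
    have "{f. f \<in> ?I \<rightarrow>\<^sub>E S \<and> inj_on f ?I \<and> f ` ?I = T} =
          {f \<in> ?I \<rightarrow>\<^sub>E T. inj_on f ?I \<and> f ` ?I = T}"
      using T by (auto simp: PiE_def Pi_def)
    then have "(\<Sum>f | f \<in> ?I \<rightarrow>\<^sub>E S \<and> inj_on f ?I \<and> f ` ?I = T. (\<Prod>i=0..<p. a i (f i)) * M b f) =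
        (\<Sum>\<pi> | \<pi> permutes ?I. (\<Prod>i=0..<p. a i (restrict (?e \<circ> \<pi>) ?I i)) * M b (restrict (?e \<circ> \<pi>) ?I))"
      using sum.reindex_bij_betw[OF enumerations_bij_permutations[OF e],
          of "\<lambda>f. (\<Prod>i=0..<p. a i (f i)) * M b f"] by simp
    also have "\<dots> = (\<Sum>\<pi> | \<pi> permutes ?I. (\<Prod>i=0..<p. a i (?e (\<pi> i))) * (signof \<pi> * M b ?e))"
    proof (rule sum.cong[OF refl])
      fix \<pi> assume "\<pi> \<in> {\<pi>. \<pi> permutes ?I}"
      then have \<pi>: "\<pi> permutes ?I" by simp
      have "M b (restrict (?e \<circ> \<pi>) ?I) = M b (?e \<circ> \<pi>)"
        by (rule M_cong) auto
      then show "(\<Prod>i=0..<p. a i (restrict (?e \<circ> \<pi>) ?I i)) * M b (restrict (?e \<circ> \<pi>) ?I) =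
          (\<Prod>i=0..<p. a i (?e (\<pi> i))) * (signof \<pi> * M b ?e)"
        using M_perm[OF \<pi>, of b ?e] by simp
    qed
    also have "\<dots> = (\<Sum>\<pi> | \<pi> permutes ?I. signof \<pi> * (\<Prod>i=0..<p. a i (?e (\<pi> i)))) * M b ?e"
      by (simp add: sum_distrib_left sum_distrib_right mult_ac)
    also have "(\<Sum>\<pi> | \<pi> permutes ?I. signof \<pi> * (\<Prod>i=0..<p. a i (?e (\<pi> i)))) = M a ?e"
      unfolding M_def det_mat_transpose[of p "\<lambda>j i. a j (?e i)"]
      by (simp add: det_mat_fun)
    finally show ?thesis .
  qed
  have "Determinant.det (Matrix.mat p p (\<lambda>(i,j). \<Sum>s\<in>S. a i s * b j s)) =
      (\<Sum>\<sigma> | \<sigma> permutes ?I. signof \<sigma> * (\<Prod>i=0..<p. \<Sum>s\<in>S. a i s * b (\<sigma> i) s))"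
    by (rule det_mat_fun)
  also have "\<dots> = (\<Sum>\<sigma> | \<sigma> permutes ?I. \<Sum>f\<in>?I \<rightarrow>\<^sub>E S.
      (\<Prod>i=0..<p. a i (f i)) * (signof \<sigma> * (\<Prod>i=0..<p. b (\<sigma> i) (f i))))"
    using fin by (subst prod_sum_PiE) (auto simp: sum_distrib_left prod.distrib mult_ac)
  also have "\<dots> = (\<Sum>f\<in>?I \<rightarrow>\<^sub>E S. (\<Prod>i=0..<p. a i (f i)) * M b f)"
    by (subst sum.swap) (simp add: M_eq sum_distrib_left)
  also have "\<dots> = (\<Sum>f | f \<in> ?I \<rightarrow>\<^sub>E S \<and> inj_on f ?I. (\<Prod>i=0..<p. a i (f i)) * M b f)"
    using fin by (intro sum.mono_neutral_right) (auto simp: M_noninj intro: finite_PiE)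
  also have "\<dots> = (\<Sum>T | T \<subseteq> S \<and> card T = p.
      \<Sum>f | f \<in> {f. f \<in> ?I \<rightarrow>\<^sub>E S \<and> inj_on f ?I} \<and> f ` ?I = T. (\<Prod>i=0..<p. a i (f i)) * M b f)"
  proof (rule sum.group[symmetric])
    show "finite {f. f \<in> ?I \<rightarrow>\<^sub>E S \<and> inj_on f ?I}"
      using fin by (auto intro: finite_subset[OF _ finite_PiE[of ?I "\<lambda>_. S"]])
    show "finite {T. T \<subseteq> S \<and> card T = p}"
      using fin by simp
    show "(\<lambda>f. f ` ?I) ` {f. f \<in> ?I \<rightarrow>\<^sub>E S \<and> inj_on f ?I} \<subseteq> {T. T \<subseteq> S \<and> card T = p}"
      by (auto simp: card_image)
  qed
  also have "\<dots> = (\<Sum>T | T \<subseteq> S \<and> card T = p.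
      M a ((!) (sorted_list_of_set T)) * M b ((!) (sorted_list_of_set T)))"
    by (rule sum.cong[OF refl]) (use fibre in \<open>simp add: conj_assoc\<close>)
  finally show ?thesis
    unfolding M_def det_mat_transpose[of p "\<lambda>j i. _ j (_ ! i)"] .
qed

section \<open>Low-rank updates of determinants\<close>

text \<open>
  The block matrix with rows \<open>(A, - X)\<close> and \<open>(Y, 1)\<close> can be made block triangular by a unitriangular
  factor in two ways: clearing the block \<open>Y\<close> leaves \<open>A + X Y\<close> in the corner, clearing the block
  \<open>- X\<close> leaves \<open>1 + Y A\<inverse> X\<close>. Here \<open>H\<close> is the inverse of \<open>A\<close>.
\<close>

lemma det_add_mult:
  fixes A :: "'a::idom mat"
  assumes A: "A \<in> carrier_mat n n" and H: "H \<in> carrier_mat n n" and AH: "A * H = 1\<^sub>m n"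
    and X: "X \<in> carrier_mat n k" and Y: "Y \<in> carrier_mat k n"
  shows "Determinant.det (A + X * Y) = Determinant.det A * Determinant.det (1\<^sub>m k + Y * (H * X))"
proof -
  let ?M = "four_block_mat A (- X) Y (1\<^sub>m k)"
  let ?L = "four_block_mat (1\<^sub>m n) (0\<^sub>m n k) (- Y) (1\<^sub>m k)"
  let ?R = "four_block_mat (1\<^sub>m n) (H * X) (0\<^sub>m k n) (1\<^sub>m k)"
  note carr = A H X Y
  have M: "?M \<in> carrier_mat (n + k) (n + k)" and L: "?L \<in> carrier_mat (n + k) (n + k)"
    and R: "?R \<in> carrier_mat (n + k) (n + k)"
    using carr by auto
  have detL: "Determinant.det ?L = 1"
    using carr by (subst det_four_block_mat_upper_right_zero[where n=n and m=k]) auto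
  have detR: "Determinant.det ?R = 1"
    using carr by (subst det_four_block_mat_lower_left_zero[where n=n and m=k]) auto
  have "?M * ?L = four_block_mat (A * 1\<^sub>m n + (- X) * (- Y)) (A * 0\<^sub>m n k + (- X) * 1\<^sub>m k)
      (Y * 1\<^sub>m n + 1\<^sub>m k * (- Y)) (Y * 0\<^sub>m n k + 1\<^sub>m k * 1\<^sub>m k)"
    using carr by (intro mult_four_block_mat) auto
  also have "\<dots> = four_block_mat (A + X * Y) (- X) (0\<^sub>m k n) (1\<^sub>m k)"
    using carr by (intro cong_four_block_mat) auto
  finally have PL: "?M * ?L = four_block_mat (A + X * Y) (- X) (0\<^sub>m k n) (1\<^sub>m k)" .
  have "?M * ?R = four_block_mat (A * 1\<^sub>m n + (- X) * 0\<^sub>m k n) (A * (H * X) + (- X) * 1\<^sub>m k)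
      (Y * 1\<^sub>m n + 1\<^sub>m k * 0\<^sub>m k n) (Y * (H * X) + 1\<^sub>m k * 1\<^sub>m k)"
    using carr by (intro mult_four_block_mat) auto
  also have "A * (H * X) = X"
    using carr AH by (simp flip: assoc_mult_mat[OF A H X])
  also have "four_block_mat (A * 1\<^sub>m n + (- X) * 0\<^sub>m k n) (X + (- X) * 1\<^sub>m k)
      (Y * 1\<^sub>m n + 1\<^sub>m k * 0\<^sub>m k n) (Y * (H * X) + 1\<^sub>m k * 1\<^sub>m k) =
      four_block_mat A (0\<^sub>m n k) Y (1\<^sub>m k + Y * (H * X))"
    using carr by (intro cong_four_block_mat) (auto intro!: eq_matI)
  finally have PR: "?M * ?R = four_block_mat A (0\<^sub>m n k) Y (1\<^sub>m k + Y * (H * X))" .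
  have "Determinant.det (A + X * Y) = Determinant.det (?M * ?L)"
    unfolding PL using carr by (subst det_four_block_mat_lower_left_zero[where n=n and m=k]) auto
  also have "\<dots> = Determinant.det (?M * ?R)"
    using det_mult[OF M L] det_mult[OF M R] detL detR by simp
  also have "\<dots> = Determinant.det A * Determinant.det (1\<^sub>m k + Y * (H * X))"
    unfolding PR using carr by (subst det_four_block_mat_upper_right_zero[where n=n and m=k]) auto
  finally show ?thesis .
qed

lemma det_mat_2: "Determinant.det (Matrix.mat 2 2 (\<lambda>(i,j). c i j)) = c 0 0 * c 1 1 - c 0 1 * c 1 (0::nat)"
proof -
  have "{\<sigma>. \<sigma> permutes {0..<2::nat}} = {id, Transposition.transpose 0 1}"
  proof -
    have "{0..<2::nat} = {0, 1}" by auto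
    then show ?thesis using permutes_doubleton_iff[of _ "0::nat" 1] by auto
  qed
  moreover have "id \<noteq> Transposition.transpose 0 (1::nat)"
    by (metis id_apply transpose_apply_first zero_neq_one)
  ultimately show ?thesis
    by (subst det_def'[where n=2]) (auto simp: numeral_2_eq_2 sign_swap_id)
qed

section \<open>Log-submodularity of sums of squared minors\<close>

text \<open>
  The weight that the squared absolute values of the maximal minors give to the \<open>p\<close>-subsets of \<open>S\<close>.
  For a determinantal process it is \<open>P(\<phi> \<subseteq> S)\<close>.
\<close>

definition minor_mass :: "nat \<Rightarrow> (nat \<Rightarrow> 's::linorder \<Rightarrow> complex) \<Rightarrow> 's set \<Rightarrow> real" where
  "minor_mass p a S = (\<Sum>T | T \<subseteq> S \<and> card T = p.
     (cmod (Determinant.det (Matrix.mat p p (\<lambda>(i,j). a i (sorted_list_of_set T ! j)))))\<^sup>2)"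

definition gram_mat :: "nat \<Rightarrow> (nat \<Rightarrow> 's \<Rightarrow> complex) \<Rightarrow> 's set \<Rightarrow> complex Matrix.mat" where
  "gram_mat p a S = Matrix.mat p p (\<lambda>(i,j). \<Sum>s\<in>S. a i s * cnj (a j s))"

lemma gram_mat_carrier [simp]: "gram_mat p a S \<in> carrier_mat p p"
  by (simp add: gram_mat_def)

lemma minor_mass_nonneg: "0 \<le> minor_mass p a S"
  by (simp add: minor_mass_def sum_nonneg)

lemma det_mat_cnj: "Determinant.det (Matrix.mat p p (\<lambda>(i,j). cnj (c i j))) =
    cnj (Determinant.det (Matrix.mat p p (\<lambda>(i,j). c i j)))"
  by (simp add: det_mat_fun)

lemma minor_mass_eq_det_gram:
  assumes "finite S"
  shows "complex_of_real (minor_mass p a S) = Determinant.det (gram_mat p a S)"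
  unfolding gram_mat_def minor_mass_def Cauchy_Binet[OF assms]
  by (simp only: det_mat_cnj of_real_sum complex_norm_square)

lemma inverse_hermitian:
  fixes G H :: "complex Matrix.mat"
  assumes G: "G \<in> carrier_mat n n" and H: "H \<in> carrier_mat n n" and GH: "G * H = 1\<^sub>m n"
    and herm: "\<And>i j. i < n \<Longrightarrow> j < n \<Longrightarrow> G $$ (j, i) = cnj (G $$ (i, j))"
    and ij: "i < n" "j < n"
  shows "H $$ (j, i) = cnj (H $$ (i, j))"
proof -
  define H' where "H' = Matrix.mat n n (\<lambda>(i,j). cnj (H $$ (j, i)))"
  have H': "H' \<in> carrier_mat n n" by (simp add: H'_def)
  have "H' * G = 1\<^sub>m n"
  proof (rule eq_matI)
    fix i j assume "i < dim_row (1\<^sub>m n :: complex Matrix.mat)" "j < dim_col (1\<^sub>m n :: complex Matrix.mat)"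
    then have ij: "i < n" "j < n" by auto
    have "(H' * G) $$ (i, j) = (\<Sum>k=0..<n. cnj (H $$ (k, i)) * G $$ (k, j))"
      using ij G by (simp add: H'_def scalar_prod_def)
    also have "\<dots> = (\<Sum>k=0..<n. cnj (G $$ (j, k) * H $$ (k, i)))"
    proof (intro sum.cong refl)
      fix k assume "k \<in> {0..<n}"
      then have "G $$ (k, j) = cnj (G $$ (j, k))" using ij by (intro herm) auto
      then show "cnj (H $$ (k, i)) * G $$ (k, j) = cnj (G $$ (j, k) * H $$ (k, i))"
        by simp
    qed
    also have "\<dots> = cnj ((G * H) $$ (j, i))"
      using ij G H by (simp add: scalar_prod_def)
    finally show "(H' * G) $$ (i, j) = 1\<^sub>m n $$ (i, j)"
      using ij by (simp add: GH)
  qed (use G in \<open>auto simp: H'_def\<close>)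
  then have "H' = H"
    using assoc_mult_mat[OF H' G H] GH H H' by simp
  then have "H $$ (j, i) = H' $$ (j, i)" by simp
  then show ?thesis using ij by (simp add: H'_def)
qed

text \<open>
  Adding \<open>k\<close> new points is a rank-\<open>k\<close> update of the Gram matrix. The inner double sum is the sesquilinear
  form of the inverse Gram matrix \<open>H\<close>, evaluated at the values of \<open>a\<close> at two new points.
\<close>

lemma det_gram_mat_Un:
  fixes a :: "nat \<Rightarrow> 's \<Rightarrow> complex"
  assumes fin: "finite S" and inj: "inj_on x {0..<k}" and disj: "x ` {0..<k} \<inter> S = {}"
    and H: "H \<in> carrier_mat p p" and GH: "gram_mat p a S * H = 1\<^sub>m p"
  shows "Determinant.det (gram_mat p a (x ` {0..<k} \<union> S)) = Determinant.det (gram_mat p a S) *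
    Determinant.det (Matrix.mat k k (\<lambda>(c,d). (if c = d then 1 else 0) +
      (\<Sum>i=0..<p. cnj (a i (x c)) * (\<Sum>j=0..<p. H $$ (i, j) * a j (x d)))))"
proof -
  define X where "X = Matrix.mat p k (\<lambda>(i,c). a i (x c))"
  define Y where "Y = Matrix.mat k p (\<lambda>(c,i). cnj (a i (x c)))"
  have X: "X \<in> carrier_mat p k" and Y: "Y \<in> carrier_mat k p"
    by (auto simp: X_def Y_def)
  have sum_split: "(\<Sum>s\<in>x ` {0..<k} \<union> S. f s) = (\<Sum>s\<in>S. f s) + (\<Sum>c=0..<k. f (x c))" for f :: "'s \<Rightarrow> complex"
    using fin disj inj by (subst sum.union_disjoint) (auto simp: sum.reindex)
  have "gram_mat p a (x ` {0..<k} \<union> S) = gram_mat p a S + X * Y"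
    by (rule eq_matI) (auto simp: gram_mat_def X_def Y_def scalar_prod_def sum_split)
  moreover have "1\<^sub>m k + Y * (H * X) = Matrix.mat k k (\<lambda>(c,d). (if c = d then 1 else 0) +
      (\<Sum>i=0..<p. cnj (a i (x c)) * (\<Sum>j=0..<p. H $$ (i, j) * a j (x d))))"
    using H by (intro eq_matI) (auto simp: X_def Y_def scalar_prod_def)
  ultimately show ?thesis
    using det_add_mult[OF gram_mat_carrier H GH X Y] by simp
qed

text \<open>
  The gap between the two sides is \<open>(minor_mass p a S)\<^sup>2 * \<bar>h x y\<bar>\<^sup>2\<close>, where \<open>h\<close> is the sesquilinear form of
  the inverse Gram matrix of \<open>S\<close>.
\<close>

lemma minor_mass_log_submodular:
  fixes a :: "nat \<Rightarrow> 's::linorder \<Rightarrow> complex"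
  assumes fin: "finite S" and xy: "x \<notin> S" "y \<notin> S" "x \<noteq> y"
  shows "minor_mass p a S * minor_mass p a (insert x (insert y S)) \<le>
         minor_mass p a (insert x S) * minor_mass p a (insert y S)"
proof (cases "minor_mass p a S = 0")
  case True
  then show ?thesis by (simp add: minor_mass_nonneg)
next
  case False
  let ?G = "gram_mat p a S" and ?m = "minor_mass p a"
  have "Determinant.det ?G \<noteq> 0"
    using False minor_mass_eq_det_gram[OF fin, of p a] by (metis of_real_eq_0_iff)
  from det_non_zero_imp_unit[OF gram_mat_carrier this]
  obtain H where H: "H \<in> carrier_mat p p" and GH: "?G * H = 1\<^sub>m p"
    by (auto simp: Units_def ring_mat_def)
  have herm: "H $$ (j, i) = cnj (H $$ (i, j))" if "i < p" "j < p" for i j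
    by (rule inverse_hermitian[OF gram_mat_carrier H GH _ that]) (simp add: gram_mat_def mult_ac)
  define h where "h u v = (\<Sum>i=0..<p. cnj (a i u) * (\<Sum>j=0..<p. H $$ (i, j) * a j v))" for u v
  have h_cnj: "h v u = cnj (h u v)" for u v
  proof -
    have "h v u = (\<Sum>i=0..<p. \<Sum>j=0..<p. cnj (a i v) * (H $$ (i, j) * a j u))"
      by (simp add: h_def sum_distrib_left)
    also have "\<dots> = (\<Sum>j=0..<p. \<Sum>i=0..<p. cnj (a i v) * (H $$ (i, j) * a j u))"
      by (rule sum.swap)
    also have "\<dots> = (\<Sum>j=0..<p. \<Sum>i=0..<p. cnj (cnj (a j u) * (H $$ (j, i) * a i v)))"
    proof (intro sum.cong refl)
      fix i j assume "i \<in> {0..<p}" "j \<in> {0..<p}"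
      then have "H $$ (j, i) = cnj (H $$ (i, j))" by (intro herm) auto
      then show "cnj (a i v) * (H $$ (i, j) * a j u) = cnj (cnj (a j u) * (H $$ (j, i) * a i v))"
        by simp
    qed
    also have "\<dots> = cnj (h u v)"
      by (simp add: h_def sum_distrib_left)
    finally show ?thesis .
  qed
  have one: "complex_of_real (?m (insert u S)) = complex_of_real (?m S) * (1 + h u u)" if "u \<notin> S" for u
  proof -
    have "Determinant.det (gram_mat p a ((\<lambda>_. u) ` {0..<1::nat} \<union> S)) = Determinant.det ?G * (1 + h u u)"
      by (subst det_gram_mat_Un[OF fin _ _ H GH]) (use that in \<open>auto simp: h_def det_single\<close>)
    then show ?thesis
      using fin by (simp add: minor_mass_eq_det_gram)
  qed
  have two: "complex_of_real (?m (insert x (insert y S))) =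
      complex_of_real (?m S) * ((1 + h x x) * (1 + h y y) - h x y * h y x)"
  proof -
    let ?x = "\<lambda>c::nat. if c = 0 then x else y"
    have img: "?x ` {0..<2} = {x, y}" by (simp add: numeral_2_eq_2 atLeast0_lessThan_Suc insert_commute)
    have "Determinant.det (gram_mat p a (?x ` {0..<2} \<union> S)) = Determinant.det ?G *
        ((1 + h x x) * (1 + h y y) - h x y * h y x)"
      by (subst det_gram_mat_Un[OF fin _ _ H GH])
        (use xy in \<open>auto simp: inj_on_def h_def[symmetric] det_mat_2\<close>)
    then show ?thesis
      using fin unfolding img by (simp add: minor_mass_eq_det_gram)
  qed
  have "complex_of_real (?m (insert x S) * ?m (insert y S) - ?m S * ?m (insert x (insert y S))) =
      complex_of_real ((?m S)\<^sup>2) * (h x y * h y x)"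
    unfolding of_real_diff of_real_mult of_real_power one[OF xy(1)] one[OF xy(2)] two
    by (simp add: algebra_simps power2_eq_square)
  also have "\<dots> = complex_of_real ((?m S)\<^sup>2 * (cmod (h x y))\<^sup>2)"
    by (simp add: h_cnj[of y x] complex_norm_square flip: of_real_power)
  finally have "?m (insert x S) * ?m (insert y S) - ?m S * ?m (insert x (insert y S)) =
      (?m S)\<^sup>2 * (cmod (h x y))\<^sup>2"
    unfolding of_real_eq_iff .
  moreover have "0 \<le> (?m S)\<^sup>2 * (cmod (h x y))\<^sup>2" by simp
  ultimately show ?thesis by linarith
qed

section \<open>Distinct hits of random sets with log-submodular avoidance function\<close>

text \<open>
  The pairwise inequality says that the ratio \<open>F (S \<union> {x}) / F S\<close> does not grow when a single point is
  added to \<open>S\<close>. Multiplying such ratios along a chain from \<open>S\<close> to \<open>T\<close>, and then along the points of \<open>X\<close>,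
  gives the general statement. Monotonicity disposes of vanishing denominators: if \<open>F\<close> vanishes at a
  set on the chain, then it vanishes at \<open>S\<close> already.
\<close>

lemma log_submodular_of_pairs:
  fixes F :: "'a set \<Rightarrow> real"
  assumes fin: "finite U"
    and nonneg: "\<And>S. 0 \<le> F S"
    and mono: "\<And>S T. S \<subseteq> T \<Longrightarrow> T \<subseteq> U \<Longrightarrow> F S \<le> F T"
    and pair: "\<And>S x y. S \<subseteq> U \<Longrightarrow> x \<in> U - S \<Longrightarrow> y \<in> U - S \<Longrightarrow> x \<noteq> y \<Longrightarrow>
       F S * F (insert x (insert y S)) \<le> F (insert x S) * F (insert y S)"
    and ST: "S \<subseteq> T" "T \<subseteq> U" "X \<subseteq> U"
  shows "F S * F (T \<union> X) \<le> F (S \<union> X) * F T"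
proof -
  have zero: "F S = 0" if "F T = 0" "S \<subseteq> T" "T \<subseteq> U" for S T
    using mono[OF that(2,3)] nonneg[of S] that(1) by simp
  have single: "F S * F (insert x T) \<le> F (insert x S) * F T" if "S \<subseteq> T" "T \<subseteq> U" "x \<in> U" for S T x
  proof (cases "x \<in> T")
    case True
    then show ?thesis
      using mono[of S "insert x S"] nonneg[of T] that
      by (auto simp: insert_absorb intro: mult_right_mono)
  next
    case False
    have fT: "finite T" using that fin finite_subset by blast
    have "F S * F (insert x (S \<union> Y)) \<le> F (insert x S) * F (S \<union> Y)"
      if "finite Y" "Y \<subseteq> T - S" for Y
      using that
    proof (induction Y)
      case empty
      then show ?case by simp
    next
      case (insert y Y)
      let ?T = "S \<union> Y"
      have sub: "?T \<subseteq> U" "insert y ?T \<subseteq> U" "x \<in> U - ?T" "y \<in> U - ?T" "x \<noteq> y" "insert x ?T \<subseteq> U"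
        using insert \<open>S \<subseteq> T\<close> \<open>T \<subseteq> U\<close> \<open>x \<in> U\<close> False by auto
      show ?case
      proof (cases "F ?T = 0")
        case True
        then have "F S = 0" using zero[of ?T S] sub by auto
        then show ?thesis using nonneg by simp
      next
        case False
        then have pos: "0 < F ?T" using nonneg[of ?T] by simp
        have "F ?T * (F S * F (insert x (insert y ?T))) = F S * (F ?T * F (insert x (insert y ?T)))"
          by simp
        also have "\<dots> \<le> F S * (F (insert x ?T) * F (insert y ?T))"
          using pair[OF sub(1,3,4,5)] nonneg by (intro mult_left_mono) auto
        also have "\<dots> = (F S * F (insert x ?T)) * F (insert y ?T)"
          by simp
        also have "\<dots> \<le> (F (insert x S) * F ?T) * F (insert y ?T)"
          using insert nonneg by (intro mult_right_mono) auto
        finally have "F ?T * (F S * F (insert x (insert y ?T))) \<le> F ?T * (F (insert x S) * F (insert y ?T))"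
          by (simp add: mult_ac)
        then show ?thesis using pos by simp
      qed
    qed
    from this[of "T - S"] show ?thesis
      using fT \<open>S \<subseteq> T\<close> by (simp add: Un_absorb1)
  qed
  have "finite X" using fin ST finite_subset by blast
  then show ?thesis using ST(3)
  proof (induction X)
    case empty
    then show ?case by simp
  next
    case (insert x X)
    show ?case
    proof (cases "F (S \<union> X) = 0")
      case True
      then have "F S = 0" using zero[of "S \<union> X" S] insert ST by auto
      then show ?thesis using nonneg by simp
    next
      case False
      then have pos: "0 < F (S \<union> X)" using nonneg[of "S \<union> X"] by simp
      have "F (S \<union> X) * (F S * F (insert x (T \<union> X))) = F S * (F (S \<union> X) * F (insert x (T \<union> X)))"
        by simp
      also have "\<dots> \<le> F S * (F (insert x (S \<union> X)) * F (T \<union> X))"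
        using insert ST nonneg by (intro mult_left_mono single) auto
      also have "\<dots> = F (insert x (S \<union> X)) * (F S * F (T \<union> X))"
        by simp
      also have "\<dots> \<le> F (insert x (S \<union> X)) * (F (S \<union> X) * F T)"
        using insert nonneg by (intro mult_left_mono) auto
      finally have "F (S \<union> X) * (F S * F (insert x (T \<union> X))) \<le> F (S \<union> X) * (F (insert x (S \<union> X)) * F T)"
        by (simp add: mult_ac)
      then show ?thesis using pos by simp
    qed
  qed
qed

text \<open>
  A negative correlation inequality for any random subset of a finite set whose avoidance function is
  log-submodular; \<open>\<mu>\<close> is its law.
\<close>

lemma distinct_hits_bound:
  fixes \<mu> :: "'a set measure"
  assumes prob: "prob_space \<mu>" and sets: "sets \<mu> = Pow (Pow U)" and fin: "finite U"
    and AB: "A \<subseteq> U" "B \<subseteq> U"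
    and pair: "\<And>S x y. S \<subseteq> U \<Longrightarrow> x \<in> U - S \<Longrightarrow> y \<in> U - S \<Longrightarrow> x \<noteq> y \<Longrightarrow>
       measure \<mu> (Pow S) * measure \<mu> (Pow (insert x (insert y S)))
         \<le> measure \<mu> (Pow (insert x S)) * measure \<mu> (Pow (insert y S))"
  shows "measure \<mu> {K. K \<subseteq> U \<and> (\<exists>a\<in>K \<inter> A. \<exists>b\<in>K \<inter> B. a \<noteq> b)}
    \<le> measure \<mu> {K. K \<subseteq> U \<and> K \<inter> A \<noteq> {}} * measure \<mu> {K. K \<subseteq> U \<and> K \<inter> B \<noteq> {}}"
proof -
  interpret prob_space \<mu> by fact
  have space: "space \<mu> = Pow U"
    using sets_eq_imp_space_eq[of \<mu> "count_space (Pow U)"] sets by simp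
  define F where "F S = prob (Pow S)" for S
  have mono: "F S \<le> F T" if "S \<subseteq> T" "T \<subseteq> U" for S T
    unfolding F_def using that sets by (intro finite_measure_mono) auto
  have F_U: "F U = 1"
    using prob_space space by (simp add: F_def)
  have lattice: "F S * F (T \<union> X) \<le> F (S \<union> X) * F T" if "S \<subseteq> T" "T \<subseteq> U" "X \<subseteq> U" for S T X
    using fin mono pair that unfolding F_def
    by (intro log_submodular_of_pairs[where U = U]) auto
  have hits: "prob {K. K \<subseteq> U \<and> K \<inter> X \<noteq> {}} = 1 - F (U - X)" for X
  proof -
    have "{K. K \<subseteq> U \<and> K \<inter> X \<noteq> {}} = space \<mu> - Pow (U - X)"
      using space by auto
    then show ?thesis
      unfolding F_def using sets by (subst prob_compl[symmetric]) auto
  qed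
  define C where "C = A \<inter> B"
  define D where "D = U - (A \<union> B)"
  \<comment> \<open>\<open>E c\<close>: the random set meets \<open>A \<union> B\<close> in the single point \<open>c\<close>.\<close>
  define E where "E c = {K. K \<subseteq> insert c D \<and> c \<in> K}" for c
  have sub: "C \<subseteq> U" "D \<subseteq> U" "finite C"
    using AB finite_subset[OF AB(1) fin] by (auto simp: C_def D_def)
  have E_sets: "E c \<in> sets \<mu>" if "c \<in> C" for c
    using that sub sets by (auto simp: E_def)
  have prob_E: "prob (E c) = F (insert c D) - F D" if "c \<in> C" for c
  proof -
    have "E c = Pow (insert c D) - Pow D"
      using that by (auto simp: E_def C_def D_def)
    moreover have "Pow (insert c D) \<in> sets \<mu>" "Pow D \<in> sets \<mu>"
      using that sub sets by auto
    ultimately show ?thesis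
      unfolding F_def by (simp add: finite_measure_Diff Pow_mono subset_insertI)
  qed
  define q where "q = (\<Sum>c\<in>C. F (insert c D) - F D)"
  have prob_UN_E: "prob (\<Union>c\<in>C. E c) = q"
  proof -
    have "E c \<inter> E d = {}" if "c \<in> C" "d \<in> C" "c \<noteq> d" for c d
    proof -
      have "d \<notin> insert c D" using that by (auto simp: C_def D_def)
      then show ?thesis by (auto simp: E_def)
    qed
    then have "disjoint_family_on E C"
      by (simp add: disjoint_family_on_def)
    then have "prob (\<Union>c\<in>C. E c) = (\<Sum>c\<in>C. prob (E c))"
      using sub E_sets by (intro finite_measure_finite_Union) auto
    then show ?thesis
      unfolding q_def by (simp add: prob_E)
  qed
  have prob_Un: "prob (Pow (U - A) \<union> Pow (U - B)) = F (U - A) + F (U - B) - F D"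
  proof -
    have "Pow (U - A) \<inter> Pow (U - B) = Pow D" by (auto simp: D_def)
    then show ?thesis
      unfolding F_def using sets by (subst measure_Un3) (auto simp: fmeasurable_eq_sets)
  qed
  let ?H = "{K. K \<subseteq> U \<and> (\<exists>a\<in>K \<inter> A. \<exists>b\<in>K \<inter> B. a \<noteq> b)}"
  let ?L = "Pow (U - A) \<union> Pow (U - B)" and ?E = "\<Union>c\<in>C. E c"
  have meas: "?H \<in> sets \<mu>" "?L \<in> sets \<mu>" "?E \<in> sets \<mu>"
    using sets E_sets sub by auto
  have "prob ?H + (prob ?L + prob ?E) = prob (?H \<union> (?L \<union> ?E))"
  proof -
    have "?L \<inter> ?E = {}" by (auto simp: E_def C_def)
    moreover have "?H \<inter> (?L \<union> ?E) = {}"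
    proof -
      have "K \<inter> A \<subseteq> {c}" "K \<inter> B \<subseteq> {c}" if "K \<in> E c" for K c
        using that by (auto simp: E_def D_def)
      then have "?H \<inter> ?E = {}" by blast
      moreover have "?H \<inter> ?L = {}" by auto
      ultimately show ?thesis by (simp only: Int_Un_distrib Un_empty)
    qed
    ultimately show ?thesis
      using meas by (simp add: finite_measure_Union)
  qed
  then have H_le: "prob ?H \<le> 1 - (F (U - A) + F (U - B) - F D + q)"
    unfolding prob_Un prob_UN_E using prob_le_1[of "?H \<union> (?L \<union> ?E)"] by linarith
  \<comment> \<open>Log-submodularity for adding \<open>A - B\<close> to \<open>D\<close> and to the larger set \<open>U - A\<close>.\<close>
  have F_D_C: "F D * F (U - C) \<le> F (U - B) * F (U - A)"
  proof -
    have eqs: "U - A \<union> (A - B) = U - C" "D \<union> (A - B) = U - B"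
      using AB by (auto simp: C_def D_def)
    have "F D * F (U - A \<union> (A - B)) \<le> F (D \<union> (A - B)) * F (U - A)"
      using AB by (intro lattice) (auto simp: D_def)
    then show ?thesis
      unfolding eqs .
  qed
  \<comment> \<open>Adding \<open>c\<close> to \<open>D\<close> and to the larger set \<open>U - {c}\<close>, where \<open>F\<close> rises to \<open>F U = 1\<close>.\<close>
  have one_point: "F D * (1 - F (U - {c})) \<le> F (insert c D) - F D" if "c \<in> C" for c
  proof -
    have c: "c \<in> U" "c \<notin> D" using that sub by (auto simp: C_def D_def)
    then have eqs: "U - {c} \<union> {c} = U" "D \<union> {c} = insert c D" by auto
    have "D \<subseteq> U - {c}" "U - {c} \<subseteq> U" "{c} \<subseteq> U"
      using c sub(2) by blast+
    then have "F D * F (U - {c} \<union> {c}) \<le> F (D \<union> {c}) * F (U - {c})"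
      by (rule lattice)
    then have "F D \<le> F (insert c D) * F (U - {c})"
      unfolding eqs F_U by simp
    also have "\<dots> = F (insert c D) - F (insert c D) * (1 - F (U - {c}))"
      by (simp add: algebra_simps)
    also have "\<dots> \<le> F (insert c D) - F D * (1 - F (U - {c}))"
      using mono[of D "insert c D"] mono[of "U - {c}" U] F_U c sub
      by (intro diff_left_mono mult_right_mono) auto
    finally show ?thesis by simp
  qed
  have union_bound: "1 - F (U - C) \<le> (\<Sum>c\<in>C. 1 - F (U - {c}))"
  proof -
    have "{K. K \<subseteq> U \<and> K \<inter> C \<noteq> {}} = (\<Union>c\<in>C. {K. K \<subseteq> U \<and> K \<inter> {c} \<noteq> {}})" by auto
    then have "1 - F (U - C) = prob (\<Union>c\<in>C. {K. K \<subseteq> U \<and> K \<inter> {c} \<noteq> {}})"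
      using hits[of C] by metis
    also have "\<dots> \<le> (\<Sum>c\<in>C. prob {K. K \<subseteq> U \<and> K \<inter> {c} \<noteq> {}})"
      using sub sets by (intro finite_measure_subadditive_finite) auto
    finally show ?thesis by (simp only: hits)
  qed
  have "F D * (1 - F (U - C)) \<le> F D * (\<Sum>c\<in>C. 1 - F (U - {c}))"
    using union_bound by (intro mult_left_mono) (auto simp: F_def)
  also have "\<dots> \<le> q"
    unfolding q_def sum_distrib_left by (intro sum_mono one_point)
  finally have "F D - q \<le> F (U - A) * F (U - B)"
    using F_D_C by (simp add: algebra_simps)
  then have "prob ?H \<le> (1 - F (U - A)) * (1 - F (U - B))"
    using H_le by (simp add: algebra_simps)
  then show ?thesis by (simp only: hits)
qed

section \<open>Determinantal processes and events generated by simple points\<close>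

text \<open>
  As the ground set is finite, each member of \<open>\<AA>\<close> contains a minimal one, which is a singleton.
\<close>

lemma simple_points_event_eq_hitting:
  assumes inc: "increasing_event N \<AA>" and gen: "generated_by_simple_points \<AA>"
  shows "\<AA> = {K. K \<subseteq> {..<N} \<and> K \<inter> {a. {a} \<in> \<AA>} \<noteq> {}}"
proof (intro equalityI subsetI)
  fix K assume K: "K \<in> \<AA>"
  then have KU: "K \<subseteq> {..<N}" using inc by (auto simp: increasing_event_def)
  have "finite {L \<in> \<AA>. L \<subseteq> K}"
    using finite_subset[OF KU] by (auto intro: finite_subset[of _ "Pow K"])
  from finite_has_minimal2[OF this, of K] K
  obtain m where m: "m \<in> \<AA>" "m \<subseteq> K" "\<And>L. L \<in> \<AA> \<Longrightarrow> L \<subseteq> K \<Longrightarrow> L \<subseteq> m \<Longrightarrow> m = L"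
    by auto
  then have "m \<in> minimal_elements \<AA>"
    unfolding minimal_elements_def by blast
  then obtain a where "m = {a}"
    using gen unfolding generated_by_simple_points_def is_singleton_def by blast
  then show "K \<in> {K. K \<subseteq> {..<N} \<and> K \<inter> {a. {a} \<in> \<AA>} \<noteq> {}}"
    using m KU by auto
next
  fix K assume "K \<in> {K. K \<subseteq> {..<N} \<and> K \<inter> {a. {a} \<in> \<AA>} \<noteq> {}}"
  then obtain a where K: "K \<subseteq> {..<N}" and a: "a \<in> K" "{a} \<in> \<AA>" by auto
  have "{a} \<union> L \<in> \<AA>" if "finite L" "L \<subseteq> {..<N}" for L
    using that
  proof (induction L)
    case empty
    then show ?case using a by simp
  next
    case (insert n L)
    then have "({a} \<union> L) \<union> {n} \<in> \<AA>"
      using inc unfolding increasing_event_def by blast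
    then show ?case by (simp add: insert_commute)
  qed
  from this[OF finite_subset[OF K] K] a show "K \<in> \<AA>"
    by (simp add: insert_absorb)
qed

lemma disjoint_intersection_subset_distinct_hits:
  assumes "\<AA> = {K. K \<subseteq> {..<N} \<and> K \<inter> A \<noteq> {}}" and "\<BB> = {K. K \<subseteq> {..<N} \<and> K \<inter> B \<noteq> {}}"
  shows "disjoint_intersection N \<AA> \<BB> \<subseteq> {K. K \<subseteq> {..<N} \<and> (\<exists>a\<in>K \<inter> A. \<exists>b\<in>K \<inter> B. a \<noteq> b)}"
proof
  fix K assume "K \<in> disjoint_intersection N \<AA> \<BB>"
  then obtain L M where LM: "L \<in> \<AA>" "M \<in> \<BB>" "L \<inter> M = {}" "L \<union> M \<subseteq> K" and K: "K \<subseteq> {..<N}"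
    unfolding disjoint_intersection_def by auto
  from LM(1,2) obtain a b where "a \<in> L \<inter> A" "b \<in> M \<inter> B"
    unfolding assms by auto
  then have "a \<in> K \<inter> A" "b \<in> K \<inter> B" "a \<noteq> b"
    using LM(3,4) by auto
  then show "K \<in> {K. K \<subseteq> {..<N} \<and> (\<exists>a\<in>K \<inter> A. \<exists>b\<in>K \<inter> B. a \<noteq> b)}"
    using K by auto
qed

lemma prob_subset_eq_minor_mass:
  assumes proc: "determinantal_process M \<phi> N p z" and S: "S \<subseteq> {..<N}"
  shows "\<P>(\<omega> in M. \<phi> \<omega> \<subseteq> S) = minor_mass p (\<lambda>k i. z k $ i) S"
proof -
  interpret prob_space M
    using proc by (simp add: determinantal_process_def)
  have meas: "\<phi> \<in> measurable M (count_space (Pow {..<N}))"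
    and card: "AE \<omega> in M. card (\<phi> \<omega>) = p"
    and law: "\<And>T. T \<subseteq> {..<N} \<Longrightarrow> card T = p \<Longrightarrow>
      \<P>(\<omega> in M. \<phi> \<omega> = T) = (cmod (Determinant.det (minor_matrix p z T)))\<^sup>2"
    using proc by (auto simp: determinantal_process_def)
  have sets: "{\<omega> \<in> space M. P (\<phi> \<omega>)} \<in> sets M" for P
  proof -
    have "{\<omega> \<in> space M. P (\<phi> \<omega>)} = \<phi> -` {K \<in> Pow {..<N}. P K} \<inter> space M"
      using measurable_space[OF meas] by auto
    then show ?thesis
      using measurable_sets[OF meas, of "{K \<in> Pow {..<N}. P K}"] by auto
  qed
  let ?Ts = "{T. T \<subseteq> S \<and> card T = p}"
  have fin: "finite ?Ts"
    using finite_subset[OF S] by simp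
  have "\<P>(\<omega> in M. \<phi> \<omega> \<subseteq> S) = prob (\<Union>T\<in>?Ts. {\<omega> \<in> space M. \<phi> \<omega> = T})"
  proof (rule finite_measure_eq_AE)
    \<comment> \<open>The process takes only values with exactly \<open>p\<close> elements, up to a null set.\<close>
    show "AE \<omega> in M. (\<omega> \<in> {\<omega> \<in> space M. \<phi> \<omega> \<subseteq> S}) = (\<omega> \<in> (\<Union>T\<in>?Ts. {\<omega> \<in> space M. \<phi> \<omega> = T}))"
      using card by eventually_elim auto
  qed (use fin sets in auto)
  also have "\<dots> = (\<Sum>T\<in>?Ts. \<P>(\<omega> in M. \<phi> \<omega> = T))"
    using fin sets by (intro finite_measure_finite_Union) (auto simp: disjoint_family_on_def)
  also have "\<dots> = minor_mass p (\<lambda>k i. z k $ i) S"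
    unfolding minor_mass_def using S by (intro sum.cong) (auto simp: law minor_matrix_def)
  finally show ?thesis .
qed

theorem theorem3:
  fixes N p :: nat
    and z :: "nat \<Rightarrow> complex Matrix.vec"
    and M :: "'w measure"
    and \<phi> :: "'w \<Rightarrow> nat set"
    and \<AA> \<BB> :: "nat set set"
  assumes "1 < p" and "p < N"
    and "orthonormal_family N p z"
    and "determinantal_process M \<phi> N p z"
    and "increasing_event N \<AA>" and "{} \<notin> \<AA>" and "generated_by_simple_points \<AA>"
    and "increasing_event N \<BB>" and "{} \<notin> \<BB>" and "generated_by_simple_points \<BB>"
  shows "\<P>(\<omega> in M. \<phi> \<omega> \<in> disjoint_intersection N \<AA> \<BB>)
           \<le> \<P>(\<omega> in M. \<phi> \<omega> \<in> \<AA>) * \<P>(\<omega> in M. \<phi> \<omega> \<in> \<BB>)"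
proof -
  note proc = assms(4)
  let ?U = "{..<N}"
  interpret prob_space M
    using proc by (simp add: determinantal_process_def)
  have meas: "\<phi> \<in> measurable M (count_space (Pow ?U))"
    using proc by (simp add: determinantal_process_def)
  define A where "A = {a. {a} \<in> \<AA>}"
  define B where "B = {b. {b} \<in> \<BB>}"
  have \<AA>: "\<AA> = {K. K \<subseteq> ?U \<and> K \<inter> A \<noteq> {}}"
    unfolding A_def by (rule simple_points_event_eq_hitting) fact+
  have \<BB>: "\<BB> = {K. K \<subseteq> ?U \<and> K \<inter> B \<noteq> {}}"
    unfolding B_def by (rule simple_points_event_eq_hitting) fact+
  have AB: "A \<subseteq> ?U" "B \<subseteq> ?U"
    using assms(5,8) by (auto simp: A_def B_def increasing_event_def)
  define \<mu> where "\<mu> = distr M (count_space (Pow ?U)) \<phi>"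
  have \<mu>: "measure \<mu> \<EE> = \<P>(\<omega> in M. \<phi> \<omega> \<in> \<EE>)" if "\<EE> \<subseteq> Pow ?U" for \<EE>
    unfolding \<mu>_def using that meas
    by (subst measure_distr) (auto intro!: arg_cong[where f = prob])
  have \<mu>_Pow: "measure \<mu> (Pow S) = minor_mass p (\<lambda>k i. z k $ i) S" if "S \<subseteq> ?U" for S
    using prob_subset_eq_minor_mass[OF proc that] that by (subst \<mu>) auto
  let ?H = "{K. K \<subseteq> ?U \<and> (\<exists>a\<in>K \<inter> A. \<exists>b\<in>K \<inter> B. a \<noteq> b)}"
  have "measure \<mu> (disjoint_intersection N \<AA> \<BB>) \<le> measure \<mu> ?H"
  proof -
    interpret \<mu>: prob_space \<mu>
      unfolding \<mu>_def by (rule prob_space_distr[OF meas])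
    show ?thesis
      using disjoint_intersection_subset_distinct_hits[OF \<AA> \<BB>]
      by (intro \<mu>.finite_measure_mono) (auto simp: \<mu>_def)
  qed
  also have "\<dots> \<le> measure \<mu> \<AA> * measure \<mu> \<BB>"
    unfolding \<AA> \<BB>
  proof (rule distinct_hits_bound)
    show "prob_space \<mu>"
      unfolding \<mu>_def by (rule prob_space_distr[OF meas])
    show "sets \<mu> = Pow (Pow ?U)" by (simp add: \<mu>_def)
    fix S x y assume "S \<subseteq> ?U" "x \<in> ?U - S" "y \<in> ?U - S" "x \<noteq> y"
    moreover from this have "finite S" using finite_subset by blast
    ultimately show "measure \<mu> (Pow S) * measure \<mu> (Pow (insert x (insert y S)))
        \<le> measure \<mu> (Pow (insert x S)) * measure \<mu> (Pow (insert y S))"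
      by (simp add: \<mu>_Pow minor_mass_log_submodular)
  qed (use AB in auto)
  moreover have "\<AA> \<subseteq> Pow ?U" "\<BB> \<subseteq> Pow ?U" "disjoint_intersection N \<AA> \<BB> \<subseteq> Pow ?U"
    using assms(5,8) by (auto simp: increasing_event_def disjoint_intersection_def)
  ultimately show ?thesis
    by (simp only: \<mu>)
qed

end
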